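(* Let $K\subseteq L^0$ be a wedge, and let $\Phi:[0,\infty)\to(-\infty,\infty]$ be a convex function which may take the value $\infty$ only at $0$ and which satisfies the growth condition. Then: (i) $\widehat M_\Phi$ is a face in $M_1$. (ii) Let $\mathbb Q_0,\mathbb Q_1\in M_1$, $0<x<1$, and assume that $\mathbb Q:=x\mathbb Q_0+(1-x)\mathbb Q_1\in\widehat M_\Phi$. If $\mathbb Q_0\in M_\Phi$ or $\mathbb Q_1\in M_\Phi$, then $\mathbb Q\in M_\Phi$.
   Context: $(\Omega,\mathcal F,\mathbb P)$ is a probability space and $L^0=L^0(\Omega,\mathcal F,\mathbb P)$ is the space of real random variables modulo $\mathbb P$-a.s. equality. A wedge in a real vector space is a non-empty convex set $C$ with $\lambda C\subseteq C$ for all $\lambda\ge 0$. $\mathbb E_{\mathbb Q}$ denotes expectation under $\mathbb Q$. Separating measures: $M_1=M_1(\mathbb P;K)$ is the set of all probability measures $\mathbb Q\ll\mathbb P$ such that $K\subseteq L^1(\mathbb Q)$ and $\mathbb E_{\mathbb Q}[X]\le 0$ for all $X\in K$. With $\Phi^+=\max\{\Phi,0\}$: $M_\Phi=\{\mathbb Q\in M_1:\Phi(\frac{d\mathbb Q}{d\mathbb P})\in L^1(\mathbb P)\}=\{\mathbb Q\in M_1:\mathbb E_{\mathbb P}[\Phi^+(\frac{d\mathbb Q}{d\mathbb P})]<\infty\}$ (finite entropy), and $\widehat M_\Phi=\{\mathbb Q\in M_1:\mathbb E_{\mathbb P}[\Phi^+(\frac{d\mathbb Q}{d\mathbb P})1_{\{d\mathbb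 Q/d\mathbb P\ge 1\}}]<\infty\}$ (finite loss-entropy). Growth condition on $\Phi$: for every interval $[\lambda_0,\lambda_1]\subseteq(0,\infty)$ there exist $\alpha>0$ and $\beta>0$ such that $\Phi^+(\lambda y)\le\alpha\Phi^+(y)+\beta(y+1)$ for all $y>0$ and all $\lambda\in[\lambda_0,\lambda_1]$. A convex subset $F$ of a convex set $C$ is a face of $C$ if $\alpha x+(1-\alpha)y\in F$ with $x,y\in C$ and $0<\alpha<1$ implies $x,y\in F$. *)

theory Defs
  imports "HOL-Probability.Probability"
begin

text \<open>
  A subset of \<open>L\<^sup>0(P)\<close> is represented by the set of all representatives of its elements, i.e. by
  a set of real random variables that is closed under \<open>P\<close>-almost sure equality.  This is a
  one-to-one correspondence, and the vector space operations of \<open>L\<^sup>0(P)\<close> become pointwise.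
\<close>

definition L0_subset :: "'a measure \<Rightarrow> ('a \<Rightarrow> real) set \<Rightarrow> bool" where
  "L0_subset P K \<longleftrightarrow> K \<subseteq> borel_measurable P \<and>
     (\<forall>X\<in>K. \<forall>Y\<in>borel_measurable P. (AE \<omega> in P. X \<omega> = Y \<omega>) \<longrightarrow> Y \<in> K)"

definition L0_wedge :: "'a measure \<Rightarrow> ('a \<Rightarrow> real) set \<Rightarrow> bool" where
  "L0_wedge P K \<longleftrightarrow> L0_subset P K \<and> K \<noteq> {} \<and>
     (\<forall>X\<in>K. \<forall>Y\<in>K. \<forall>a. 0 \<le> a \<and> a \<le> 1 \<longrightarrow> (\<lambda>\<omega>. a * X \<omega> + (1 - a) * Y \<omega>) \<in> K) \<and>
     (\<forall>X\<in>K. \<forall>c\<ge>0. (\<lambda>\<omega>. c * X \<omega>) \<in> K)"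

definition mix_measure :: "real \<Rightarrow> 'a measure \<Rightarrow> 'a measure \<Rightarrow> 'a measure" where
  "mix_measure x Q\<^sub>0 Q\<^sub>1 = measure_of (space Q\<^sub>0) (sets Q\<^sub>0)
     (\<lambda>A. ennreal x * emeasure Q\<^sub>0 A + ennreal (1 - x) * emeasure Q\<^sub>1 A)"

lemma space_mix_measure [simp]: "space (mix_measure x Q\<^sub>0 Q\<^sub>1) = space Q\<^sub>0"
  and sets_mix_measure [simp, measurable_cong]: "sets (mix_measure x Q\<^sub>0 Q\<^sub>1) = sets Q\<^sub>0"
  by (simp_all add: mix_measure_def)

lemma emeasure_mix_measure:
  assumes "sets Q\<^sub>0 = sets Q\<^sub>1"
  shows "emeasure (mix_measure x Q\<^sub>0 Q\<^sub>1) A =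
    ennreal x * emeasure Q\<^sub>0 A + ennreal (1 - x) * emeasure Q\<^sub>1 A"
proof (cases "A \<in> sets Q\<^sub>0")
  case True
  let ?\<mu> = "\<lambda>A. ennreal x * emeasure Q\<^sub>0 A + ennreal (1 - x) * emeasure Q\<^sub>1 A"
  have "countably_additive (sets Q\<^sub>0) ?\<mu>"
  proof (rule countably_additiveI)
    fix A :: "nat \<Rightarrow> 'a set"
    assume A: "range A \<subseteq> sets Q\<^sub>0" "disjoint_family A"
    then have "range A \<subseteq> sets Q\<^sub>1" using assms by simp
    with A show "(\<Sum>i. ?\<mu> (A i)) = ?\<mu> (\<Union>i. A i)"
      by (simp add: suminf_add[symmetric] ennreal_suminf_cmult suminf_emeasure)
  qed
  then show ?thesis
    using True unfolding mix_measure_def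
    by (intro emeasure_measure_of_sigma) (auto simp: positive_def sets.sigma_algebra_axioms)
next
  case False
  then show ?thesis using assms by (simp add: emeasure_notin_sets)
qed

definition convex_measures :: "'a measure set \<Rightarrow> bool" where
  "convex_measures C \<longleftrightarrow>
     (\<forall>Q\<^sub>0\<in>C. \<forall>Q\<^sub>1\<in>C. \<forall>a. 0 \<le> a \<and> a \<le> 1 \<longrightarrow> mix_measure a Q\<^sub>0 Q\<^sub>1 \<in> C)"

text \<open>The constant \<^const>\<open>face_of\<close> is not applicable, as measures do not form a real vector space type.\<close>

definition face_measures :: "'a measure set \<Rightarrow> 'a measure set \<Rightarrow> bool" where
  "face_measures F C \<longleftrightarrow> convex_measures C \<and> F \<subseteq> C \<and> convex_measures F \<and>
     (\<forall>Q\<^sub>0\<in>C. \<forall>Q\<^sub>1\<in>C. \<forall>a. 0 < a \<and> a < 1 \<and> mix_measure a Q\<^sub>0 Q\<^sub>1 \<in> F \<longrightarrow> Q\<^sub>0 \<in> F \<and> Q\<^sub>1 \<in> F)"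

definition sep_measures :: "'a measure \<Rightarrow> ('a \<Rightarrow> real) set \<Rightarrow> 'a measure set" where
  "sep_measures P K = {Q. prob_space Q \<and> sets Q = sets P \<and> absolutely_continuous P Q \<and>
     (\<forall>X\<in>K. integrable Q X \<and> integral\<^sup>L Q X \<le> 0)}"

text \<open>For \<open>Q\<close> finite with \<open>Q \<lless> P\<close>, the density \<^term>\<open>RN_deriv P Q\<close> is finite \<open>P\<close>-almost everywhere.\<close>

definition dens :: "'a measure \<Rightarrow> 'a measure \<Rightarrow> 'a \<Rightarrow> real" where
  "dens P Q \<omega> = enn2real (RN_deriv P Q \<omega>)"

text \<open>
  A function \<open>\<Phi> : [0,\<infinity>) \<rightarrow> (-\<infinity>,\<infinity>]\<close> is modelled as a function on the reals, whose values at
  negative arguments are irrelevant.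
\<close>

definition entropy_function :: "(real \<Rightarrow> ereal) \<Rightarrow> bool" where
  "entropy_function \<Phi> \<longleftrightarrow> (\<forall>y\<ge>0. \<Phi> y \<noteq> -\<infinity>) \<and> (\<forall>y>0. \<Phi> y \<noteq> \<infinity>) \<and>
     (\<forall>y\<ge>0. \<forall>z\<ge>0. \<forall>a. 0 < a \<and> a < 1 \<longrightarrow>
        \<Phi> (a * y + (1 - a) * z) \<le> ereal a * \<Phi> y + ereal (1 - a) * \<Phi> z)"

definition growth_condition :: "(real \<Rightarrow> ereal) \<Rightarrow> bool" where
  "growth_condition \<Phi> \<longleftrightarrow> (\<forall>l\<^sub>0 l\<^sub>1. 0 < l\<^sub>0 \<and> l\<^sub>0 \<le> l\<^sub>1 \<longrightarrow>
     (\<exists>\<alpha>>0. \<exists>\<beta>>0. \<forall>y>0. \<forall>l\<in>{l\<^sub>0..l\<^sub>1}.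
        max (\<Phi> (l * y)) 0 \<le> ereal \<alpha> * max (\<Phi> y) 0 + ereal (\<beta> * (y + 1))))"

text \<open>
  Membership in \<open>L\<^sup>1(P)\<close> of an extended real valued function: the library's \<^const>\<open>integrable\<close> only
  covers functions with values in a Banach space.
\<close>

definition ereal_integrable :: "'a measure \<Rightarrow> ('a \<Rightarrow> ereal) \<Rightarrow> bool" where
  "ereal_integrable P f \<longleftrightarrow>
     f \<in> borel_measurable P \<and> (\<integral>\<^sup>+ \<omega>. e2ennreal \<bar>f \<omega>\<bar> \<partial>P) < \<infinity>"

definition finite_entropy_measures ::
    "'a measure \<Rightarrow> ('a \<Rightarrow> real) set \<Rightarrow> (real \<Rightarrow> ereal) \<Rightarrow> 'a measure set" where
  "finite_entropy_measures P K \<Phi> =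
     {Q \<in> sep_measures P K. ereal_integrable P (\<lambda>\<omega>. \<Phi> (dens P Q \<omega>))}"

definition finite_loss_entropy_measures ::
    "'a measure \<Rightarrow> ('a \<Rightarrow> real) set \<Rightarrow> (real \<Rightarrow> ereal) \<Rightarrow> 'a measure set" where
  "finite_loss_entropy_measures P K \<Phi> =
     {Q \<in> sep_measures P K.
        (\<integral>\<^sup>+ \<omega>. e2ennreal (max (\<Phi> (dens P Q \<omega>)) 0) * indicator {\<omega>. dens P Q \<omega> \<ge> 1} \<omega> \<partial>P) < \<infinity>}"

end

(*
  Positive parts of convex functions satisfy y \<in> [a, b] \<Longrightarrow> \<Phi>\<^sup>+(y) \<le> \<Phi>\<^sup>+(a) + \<Phi>\<^sup>+(b), and the density of a
  mixture is the mixture f = x f\<^sub>0 + (1 - x) f\<^sub>1 of the densities. On {f \<ge> 1} one has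
  1 \<le> f \<le> max f\<^sub>0 f\<^sub>1, which gives convexity of the finite loss-entropy measures; on {f\<^sub>0 \<ge> 1} one has
  1 \<le> f\<^sub>0 \<le> f / x, which gives the face property; on {f < 1} one has x f\<^sub>0 \<le> f \<le> 1, which gives (ii).
  The growth condition absorbs the factors 1 / x and x up to an affine function of an integrable
  density, and the negative part of \<Phi> is affinely bounded because \<Phi> is convex.
*)
theory Submission
  imports Defs
begin

section \<open>Convex entropy functions\<close>

lemma e2ennreal_plus: "a \<ge> 0 \<Longrightarrow> b \<ge> 0 \<Longrightarrow> e2ennreal (a + b) = e2ennreal a + e2ennreal b"
  by (cases a; cases b) (auto simp: ennreal_plus)

text \<open>The positive part \<open>\<Phi>\<^sup>+\<close> with values in \<open>ennreal\<close>,
  so that a possible value \<infinity> at 0 is kept and nonnegative integrals apply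
  directly.\<close>

definition pos_entropy :: "(real \<Rightarrow> ereal) \<Rightarrow> real \<Rightarrow> ennreal" where
  "pos_entropy \<Phi> y = e2ennreal (max (\<Phi> y) 0)"

context
  fixes \<Phi> :: "real \<Rightarrow> ereal"
  assumes entropy: "entropy_function \<Phi>"
begin

lemma entropy_function_convex:
  assumes "y \<ge> 0" "z \<ge> 0" "0 < a" "a < 1"
  shows "\<Phi> (a * y + (1 - a) * z) \<le> ereal a * \<Phi> y + ereal (1 - a) * \<Phi> z"
  using entropy assms unfolding entropy_function_def by blast

lemma entropy_function_finite: "\<Phi> y = ereal (real_of_ereal (\<Phi> y))" if "y > 0"
  using entropy that by (cases "\<Phi> y") (auto simp: entropy_function_def)

lemma pos_entropy_finite: "pos_entropy \<Phi> y < \<infinity>" if "y > 0"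
proof -
  have "max (\<Phi> y) 0 = ereal (max (real_of_ereal (\<Phi> y)) 0)"
    using entropy_function_finite[OF that] by (metis ereal_max zero_ereal_def)
  then show ?thesis
    by (metis pos_entropy_def e2ennreal_ereal ennreal_less_top infinity_ennreal_def)
qed

text \<open>\<open>real_of_ereal\<close> loses nothing on the open half-line, where \<Phi> is
  finite. The real-valued version gives access to continuity and supporting lines of convex
  functions; the point 0 stays outside, since \<Phi> may be infinite there.\<close>

lemma convex_on_entropy: "convex_on {0<..} (\<lambda>y. real_of_ereal (\<Phi> y))"
proof (rule convex_onI)
  fix t y z :: real
  assume t: "0 < t" "t < 1" and yz: "y \<in> {0<..}" "z \<in> {0<..}"
  let ?w = "(1 - t) * y + t * z"
  have "?w > 0" using t yz by (auto intro!: add_pos_pos)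
  have "\<Phi> ((1 - t) * y + (1 - (1 - t)) * z) \<le> ereal (1 - t) * \<Phi> y + ereal (1 - (1 - t)) * \<Phi> z"
    using t yz by (intro entropy_function_convex) auto
  then have "\<Phi> ?w \<le> ereal (1 - t) * \<Phi> y + ereal t * \<Phi> z" by simp
  also have "\<dots> = ereal ((1 - t) * real_of_ereal (\<Phi> y) + t * real_of_ereal (\<Phi> z))"
    using entropy_function_finite[of y] entropy_function_finite[of z] yz
    by (metis greaterThan_iff plus_ereal.simps(1) times_ereal.simps(1))
  finally have "\<Phi> ?w \<le> ereal ((1 - t) * real_of_ereal (\<Phi> y) + t * real_of_ereal (\<Phi> z))" .
  then show "real_of_ereal (\<Phi> ((1 - t) *\<^sub>R y + t *\<^sub>R z))
      \<le> (1 - t) * real_of_ereal (\<Phi> y) + t * real_of_ereal (\<Phi> z)"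
    using entropy_function_finite[OF \<open>?w > 0\<close>] by (metis ereal_less_eq(3) real_scaleR_def)
qed simp

lemma pos_entropy_between:
  assumes "0 \<le> a" "a \<le> y" "y \<le> b"
  shows "pos_entropy \<Phi> y \<le> pos_entropy \<Phi> a + pos_entropy \<Phi> b"
proof (cases "a = y \<or> y = b")
  case True
  then show ?thesis by auto
next
  case False
  then have ab: "a < y" "y < b" using assms by auto
  define t where "t = (b - y) / (b - a)"
  have t: "0 < t" "t < 1" using ab by (auto simp: t_def field_simps)
  have "t * (b - a) = b - y" using ab by (simp add: t_def)
  then have y: "y = t * a + (1 - t) * b" by (simp add: algebra_simps)
  \<comment> \<open>The positive part is taken before the weight is enlarged to 1: for negative
    \<Phi> z, enlarging the weight would lower the product.\<close>
  have scale: "ereal s * \<Phi> z \<le> max (\<Phi> z) 0" if "0 \<le> s" "s \<le> 1" for s z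
  proof -
    have "ereal s * \<Phi> z \<le> ereal s * max (\<Phi> z) 0"
      using that by (intro ereal_mult_left_mono) auto
    also have "\<dots> \<le> 1 * max (\<Phi> z) 0"
      using that by (intro ereal_mult_right_mono) (auto simp: one_ereal_def)
    finally show ?thesis by simp
  qed
  have "\<Phi> y \<le> ereal t * \<Phi> a + ereal (1 - t) * \<Phi> b"
    using entropy_function_convex[of a b t] t assms ab by (simp flip: y)
  also have "\<dots> \<le> max (\<Phi> a) 0 + max (\<Phi> b) 0"
    using t by (intro add_mono scale) auto
  finally have "max (\<Phi> y) 0 \<le> max (\<Phi> a) 0 + max (\<Phi> b) 0"
    by simp
  then have "pos_entropy \<Phi> y \<le> e2ennreal (max (\<Phi> a) 0 + max (\<Phi> b) 0)"
    unfolding pos_entropy_def by (rule e2ennreal_mono)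
  also have "\<dots> = pos_entropy \<Phi> a + pos_entropy \<Phi> b"
    unfolding pos_entropy_def by (intro e2ennreal_plus) auto
  finally show ?thesis .
qed

text \<open>A supporting line at 1 bounds \<Phi> from below by an affine function. Since
  \<open>e2ennreal\<close> sends negative values to 0, the left-hand side is the negative part of
  \<Phi>.\<close>

lemma entropy_affine_lower_bound:
  obtains C where "C \<ge> 0" "\<And>y. y \<ge> 0 \<Longrightarrow> e2ennreal (- \<Phi> y) \<le> ennreal (C * (y + 1))"
proof -
  define g where "g y = real_of_ereal (\<Phi> y)" for y
  \<comment> \<open>The right derivative of g at 1, as an infimum of difference quotients in the
    form that \<open>convex_le_Inf_differential\<close> expects.\<close>
  define m where "m = Inf ((\<lambda>t. (g 1 - g t) / (1 - t)) ` ({1<..} \<inter> {0<..}))"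
  \<comment> \<open>The summand with g 0 serves y = 0, which the supporting line on the open
    half-line does not reach. If \<Phi> 0 = \<infinity>, then g 0 = 0 by default and the negative
    part vanishes.\<close>
  define C where "C = \<bar>g 1\<bar> + \<bar>m\<bar> + \<bar>g 0\<bar>"
  show thesis
  proof (rule that)
    show "C \<ge> 0" by (simp add: C_def)
    fix y :: real assume "y \<ge> 0"
    show "e2ennreal (- \<Phi> y) \<le> ennreal (C * (y + 1))"
    proof (cases "y = 0")
      case True
      have "\<bar>g 0\<bar> \<le> C" by (simp add: C_def)
      then have "- \<Phi> 0 \<le> ereal C"
        using entropy by (cases "\<Phi> 0") (auto simp: entropy_function_def g_def)
      then show ?thesis using True e2ennreal_mono[of "- \<Phi> 0" "ereal C"] by simp
    next
      case False
      then have y: "y > 0" using \<open>y \<ge> 0\<close> by simp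
      have "g y \<ge> g 1 + m * (y - 1)"
        unfolding m_def using convex_on_entropy y
        by (intro convex_le_Inf_differential) (auto simp: g_def interior_open)
      moreover have "\<bar>m * (y - 1)\<bar> \<le> \<bar>m\<bar> * (y + 1)"
        using y by (auto simp: abs_mult intro!: mult_left_mono)
      moreover have "\<bar>g 1\<bar> + \<bar>m\<bar> * (y + 1) \<le> C * (y + 1)"
      proof -
        have "\<bar>g 1\<bar> * 1 + \<bar>m\<bar> * (y + 1) + 0 \<le> \<bar>g 1\<bar> * (y + 1) + \<bar>m\<bar> * (y + 1) + \<bar>g 0\<bar> * (y + 1)"
          using y by (intro add_mono mult_left_mono) auto
        then show ?thesis by (simp add: C_def algebra_simps)
      qed
      ultimately have "- g y \<le> C * (y + 1)" by linarith
      then have "- \<Phi> y \<le> ereal (C * (y + 1))"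
        using entropy_function_finite[OF y] unfolding g_def
        by (metis ereal_less_eq(3) uminus_ereal.simps(1))
      then show ?thesis using e2ennreal_mono by fastforce
    qed
  qed
qed

text \<open>A convex function is continuous on the open half-line, hence Borel there. At 0 it may
  jump or be infinite, so this single value is split off.\<close>

lemma measurable_entropy_comp:
  assumes [measurable]: "f \<in> borel_measurable M" and nn: "\<And>\<omega>. f \<omega> \<ge> 0"
  shows "(\<lambda>\<omega>. \<Phi> (f \<omega>)) \<in> borel_measurable M"
proof -
  define h where "h y = indicator {0<..} y *\<^sub>R real_of_ereal (\<Phi> y)" for y
  have [measurable]: "h \<in> borel_measurable borel"
    unfolding h_def
    by (intro borel_measurable_continuous_on_indicator convex_on_continuous convex_on_entropy) auto
  have "\<Phi> (f \<omega>) = (if f \<omega> = 0 then \<Phi> 0 else ereal (h (f \<omega>)))" for \<omega>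
    using nn[of \<omega>] entropy_function_finite[of "f \<omega>"] by (auto simp: h_def indicator_def)
  then show ?thesis by simp
qed

lemma measurable_pos_entropy_comp:
  assumes "f \<in> borel_measurable M" and "\<And>\<omega>. f \<omega> \<ge> 0"
  shows "(\<lambda>\<omega>. pos_entropy \<Phi> (f \<omega>)) \<in> borel_measurable M"
  using measurable_entropy_comp[OF assms] unfolding pos_entropy_def by measurable

text \<open>The growth condition for the one-point interval [l, l], carried over to
  \<open>ennreal\<close>.\<close>

lemma pos_entropy_scale:
  assumes "growth_condition \<Phi>" and "l > 0"
  obtains \<alpha> \<beta> where "\<alpha> \<ge> 0" "\<beta> \<ge> 0"
    "\<And>y. y > 0 \<Longrightarrow> pos_entropy \<Phi> (l * y) \<le> ennreal \<alpha> * pos_entropy \<Phi> y + ennreal (\<beta> * (y + 1))"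
proof -
  obtain \<alpha> \<beta> where ab: "\<alpha> > 0" "\<beta> > 0" and
    le: "\<And>y. y > 0 \<Longrightarrow> max (\<Phi> (l * y)) 0 \<le> ereal \<alpha> * max (\<Phi> y) 0 + ereal (\<beta> * (y + 1))"
    using assms unfolding growth_condition_def by (metis atLeastAtMost_iff order_refl)
  show thesis
  proof (rule that[of \<alpha> \<beta>])
    fix y :: real assume y: "y > 0"
    \<comment> \<open>As \<Phi> y is finite for y > 0, the right-hand side can be computed in the
      reals, where \<open>e2ennreal\<close> respects sums and products of nonnegative
      numbers.\<close>
    obtain r where m: "max (\<Phi> y) 0 = ereal r" and "r \<ge> 0"
      using entropy_function_finite[OF y] by (metis ereal_max zero_ereal_def max.cobounded2)
    have "pos_entropy \<Phi> (l * y) \<le> e2ennreal (ereal \<alpha> * max (\<Phi> y) 0 + ereal (\<beta> * (y + 1)))"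
      unfolding pos_entropy_def using le[OF y] by (rule e2ennreal_mono)
    also have "\<dots> = ennreal \<alpha> * pos_entropy \<Phi> y + ennreal (\<beta> * (y + 1))"
      using ab y \<open>r \<ge> 0\<close> unfolding pos_entropy_def m by (simp add: ennreal_plus ennreal_mult)
    finally show "pos_entropy \<Phi> (l * y) \<le> ennreal \<alpha> * pos_entropy \<Phi> y + ennreal (\<beta> * (y + 1))" .
  qed (use ab in auto)
qed

end

section \<open>Densities of separating measures\<close>

lemma borel_measurable_dens [measurable]: "dens P Q \<in> borel_measurable P"
  unfolding dens_def[abs_def] by measurable

lemma dens_nonneg: "dens P Q \<omega> \<ge> 0"
  by (simp add: dens_def)

text \<open>Truncating the Radon-Nikodym derivative to a real function changes it only on a P-null
  set, because Q is finite.\<close>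

lemma density_dens:
  assumes "prob_space P" "prob_space Q" "sets Q = sets P" "absolutely_continuous P Q"
  shows "density P (\<lambda>\<omega>. ennreal (dens P Q \<omega>)) = Q"
proof -
  interpret P: prob_space P by fact
  interpret Q: prob_space Q by fact
  have "AE \<omega> in P. RN_deriv P Q \<omega> \<noteq> \<infinity>"
    using assms by (intro P.RN_deriv_finite Q.sigma_finite_measure_axioms) auto
  then have "AE \<omega> in P. ennreal (dens P Q \<omega>) = RN_deriv P Q \<omega>"
    by eventually_elim (auto simp: dens_def less_top)
  then have "density P (\<lambda>\<omega>. ennreal (dens P Q \<omega>)) = density P (RN_deriv P Q)"
    by (intro density_cong) auto
  then show ?thesis using P.density_RN_deriv assms by simp
qed

lemma nn_integral_dens:
  assumes "prob_space P" "prob_space Q" "sets Q = sets P" "absolutely_continuous P Q"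
  shows "(\<integral>\<^sup>+ \<omega>. ennreal (dens P Q \<omega>) \<partial>P) = 1"
proof -
  interpret Q: prob_space Q by fact
  have "emeasure (density P (\<lambda>\<omega>. ennreal (dens P Q \<omega>))) (space P) = 1"
    using density_dens[OF assms] Q.emeasure_space_1 sets_eq_imp_space_eq[OF assms(3)] by simp
  then show ?thesis by (simp add: emeasure_density cong: nn_integral_cong)
qed

text \<open>The density has integral 1, so the value is 2c. This disposes of the affine error terms
  from the growth condition and from the lower bound on \<Phi>.\<close>

lemma nn_integral_affine_dens_finite:
  assumes "prob_space P" "prob_space Q" "sets Q = sets P" "absolutely_continuous P Q" "c \<ge> 0"
  shows "(\<integral>\<^sup>+ \<omega>. ennreal (c * (dens P Q \<omega> + 1)) \<partial>P) < \<infinity>"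
proof -
  interpret P: prob_space P by fact
  have "(\<integral>\<^sup>+ \<omega>. ennreal (c * (dens P Q \<omega> + 1)) \<partial>P) =
      (\<integral>\<^sup>+ \<omega>. ennreal c * (ennreal (dens P Q \<omega>) + 1) \<partial>P)"
    using \<open>c \<ge> 0\<close> by (intro nn_integral_cong) (simp add: ennreal_mult dens_nonneg ennreal_plus)
  also have "\<dots> = ennreal c * 2"
    using nn_integral_dens[OF assms(1-4)]
    by (simp add: nn_integral_cmult nn_integral_add P.emeasure_space_1)
  finally show ?thesis by (simp add: ennreal_mult_less_top)
qed

section \<open>Mixtures of measures, their densities, and convexity of the set of separating
  measures\<close>

lemma mix_measure_density:
  assumes [measurable]: "f\<^sub>0 \<in> borel_measurable P" "f\<^sub>1 \<in> borel_measurable P"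
    and "\<And>\<omega>. f\<^sub>0 \<omega> \<ge> 0" "\<And>\<omega>. f\<^sub>1 \<omega> \<ge> 0" "0 \<le> x" "x \<le> 1"
  shows "mix_measure x (density P (\<lambda>\<omega>. ennreal (f\<^sub>0 \<omega>))) (density P (\<lambda>\<omega>. ennreal (f\<^sub>1 \<omega>))) =
    density P (\<lambda>\<omega>. ennreal (x * f\<^sub>0 \<omega> + (1 - x) * f\<^sub>1 \<omega>))"
proof (rule measure_eqI)
  fix A assume "A \<in> sets (mix_measure x (density P (\<lambda>\<omega>. ennreal (f\<^sub>0 \<omega>)))
    (density P (\<lambda>\<omega>. ennreal (f\<^sub>1 \<omega>))))"
  then have [measurable]: "A \<in> sets P" by simp
  have "(\<integral>\<^sup>+ \<omega>. ennreal (x * f\<^sub>0 \<omega> + (1 - x) * f\<^sub>1 \<omega>) * indicator A \<omega> \<partial>P) =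
      (\<integral>\<^sup>+ \<omega>. ennreal x * (ennreal (f\<^sub>0 \<omega>) * indicator A \<omega>) +
        ennreal (1 - x) * (ennreal (f\<^sub>1 \<omega>) * indicator A \<omega>) \<partial>P)"
    using assms(3-6)
    by (intro nn_integral_cong) (simp add: ennreal_plus ennreal_mult distrib_right mult.assoc)
  then show "emeasure (mix_measure x (density P (\<lambda>\<omega>. ennreal (f\<^sub>0 \<omega>)))
      (density P (\<lambda>\<omega>. ennreal (f\<^sub>1 \<omega>)))) A =
    emeasure (density P (\<lambda>\<omega>. ennreal (x * f\<^sub>0 \<omega> + (1 - x) * f\<^sub>1 \<omega>))) A"
    by (simp add: emeasure_mix_measure emeasure_density nn_integral_add nn_integral_cmult)
qed simp

text \<open>Transfers results about the first component of a mixture to the second.\<close>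

lemma mix_measure_commute:
  assumes "sets Q\<^sub>0 = sets Q\<^sub>1"
  shows "mix_measure x Q\<^sub>0 Q\<^sub>1 = mix_measure (1 - x) Q\<^sub>1 Q\<^sub>0"
  using assms by (intro measure_eqI) (auto simp: emeasure_mix_measure add.commute)

context
  fixes P :: "'a measure" and K :: "('a \<Rightarrow> real) set"
  assumes prob: "prob_space P"
begin

interpretation P: prob_space P by (rule prob)

lemma sep_measuresD:
  assumes "Q \<in> sep_measures P K"
  shows "prob_space Q" "sets Q = sets P" "absolutely_continuous P Q"
    "\<And>X. X \<in> K \<Longrightarrow> integrable Q X" "\<And>X. X \<in> K \<Longrightarrow> integral\<^sup>L Q X \<le> 0"
  using assms by (auto simp: sep_measures_def)

lemma mix_sep_measures_density:
  assumes "Q\<^sub>0 \<in> sep_measures P K" "Q\<^sub>1 \<in> sep_measures P K" "0 \<le> x" "x \<le> 1"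
  shows "mix_measure x Q\<^sub>0 Q\<^sub>1 =
    density P (\<lambda>\<omega>. ennreal (x * dens P Q\<^sub>0 \<omega> + (1 - x) * dens P Q\<^sub>1 \<omega>))"
proof -
  have "density P (\<lambda>\<omega>. ennreal (dens P Q \<omega>)) = Q" if "Q \<in> sep_measures P K" for Q
    using prob sep_measuresD(1-3)[OF that] by (rule density_dens)
  from this[OF assms(1)] this[OF assms(2)] show ?thesis
    using mix_measure_density[of "dens P Q\<^sub>0" P "dens P Q\<^sub>1" x] assms(3,4)
    by (simp add: dens_nonneg)
qed

text \<open>Radon-Nikodym derivatives are unique only almost surely, so pointwise estimates for
  mixtures are later integrated with \<open>nn_integral_mono_AE\<close>.\<close>

lemma AE_dens_mix:
  assumes "Q\<^sub>0 \<in> sep_measures P K" "Q\<^sub>1 \<in> sep_measures P K" "0 \<le> x" "x \<le> 1"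
  shows "AE \<omega> in P. dens P (mix_measure x Q\<^sub>0 Q\<^sub>1) \<omega> = x * dens P Q\<^sub>0 \<omega> + (1 - x) * dens P Q\<^sub>1 \<omega>"
proof -
  have "AE \<omega> in P. ennreal (x * dens P Q\<^sub>0 \<omega> + (1 - x) * dens P Q\<^sub>1 \<omega>) =
      RN_deriv P (mix_measure x Q\<^sub>0 Q\<^sub>1) \<omega>"
    by (rule P.RN_deriv_unique) (simp_all add: mix_sep_measures_density[OF assms])
  then show ?thesis
    by eventually_elim
      (metis add_nonneg_nonneg assms(3,4) dens_def dens_nonneg diff_ge_0_iff_ge enn2real_ennreal
        mult_nonneg_nonneg)
qed

text \<open>Every integral of X is rewritten as a P-integral of density times X. There integrability
  and linearity in the density are available, and the expectation under the mixture is a convex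
  combination of two nonpositive numbers.\<close>

lemma convex_measures_sep_measures: "convex_measures (sep_measures P K)"
  unfolding convex_measures_def
proof (intro ballI allI impI)
  fix Q\<^sub>0 Q\<^sub>1 and x :: real
  assume Q: "Q\<^sub>0 \<in> sep_measures P K" "Q\<^sub>1 \<in> sep_measures P K" and "0 \<le> x \<and> x \<le> 1"
  then have x: "0 \<le> x" "x \<le> 1" by auto
  note Q0 = sep_measuresD[OF Q(1)] and Q1 = sep_measuresD[OF Q(2)]
  let ?Q = "mix_measure x Q\<^sub>0 Q\<^sub>1"
  let ?f = "\<lambda>\<omega>. x * dens P Q\<^sub>0 \<omega> + (1 - x) * dens P Q\<^sub>1 \<omega>"
  have f: "?f \<omega> \<ge> 0" for \<omega> using x by (simp add: dens_nonneg)
  have sets: "sets Q\<^sub>0 = sets Q\<^sub>1" using Q0 Q1 by simp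
  have "emeasure ?Q (space ?Q) = ennreal x + ennreal (1 - x)"
    using prob_space.emeasure_space_1[OF Q0(1)] prob_space.emeasure_space_1[OF Q1(1)]
      sets_eq_imp_space_eq[OF sets] by (simp add: emeasure_mix_measure[OF sets])
  also have "\<dots> = 1" using x by (simp flip: ennreal_plus)
  finally have "prob_space ?Q" by (rule prob_spaceI)
  moreover have "absolutely_continuous P ?Q"
    unfolding mix_sep_measures_density[OF Q x]
    by (intro absolutely_continuousI_density) simp
  moreover have "integrable ?Q X \<and> integral\<^sup>L ?Q X \<le> 0" if "X \<in> K" for X
  proof -
    have [measurable]: "X \<in> borel_measurable P"
      using borel_measurable_integrable[OF Q0(4)[OF that]] Q0(2)
      by (metis measurable_cong_sets)
    have dens_int: "integrable P (\<lambda>\<omega>. dens P R \<omega> * X \<omega>)"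
      "integral\<^sup>L P (\<lambda>\<omega>. dens P R \<omega> * X \<omega>) = integral\<^sup>L R X"
      if "R \<in> sep_measures P K" for R
    proof -
      note R = sep_measuresD[OF that]
      note d = density_dens[OF prob R(1-3)]
      show "integrable P (\<lambda>\<omega>. dens P R \<omega> * X \<omega>)"
        using R(4)[OF \<open>X \<in> K\<close>] integrable_real_density[of "dens P R" P X]
        by (simp add: dens_nonneg d)
      show "integral\<^sup>L P (\<lambda>\<omega>. dens P R \<omega> * X \<omega>) = integral\<^sup>L R X"
        using integral_real_density[of "dens P R" P X] by (simp add: dens_nonneg d)
    qed
    have eq: "(\<lambda>\<omega>. ?f \<omega> * X \<omega>) =
        (\<lambda>\<omega>. x * (dens P Q\<^sub>0 \<omega> * X \<omega>) + (1 - x) * (dens P Q\<^sub>1 \<omega> * X \<omega>))"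
      by (simp add: algebra_simps)
    note i = dens_int(1)[OF Q(1)] dens_int(1)[OF Q(2)]
    have "integrable P (\<lambda>\<omega>. ?f \<omega> * X \<omega>)"
      unfolding eq using i by (intro Bochner_Integration.integrable_add integrable_mult_right)
    moreover have "integral\<^sup>L P (\<lambda>\<omega>. ?f \<omega> * X \<omega>) = x * integral\<^sup>L Q\<^sub>0 X + (1 - x) * integral\<^sup>L Q\<^sub>1 X"
      unfolding eq using i dens_int(2)[OF Q(1)] dens_int(2)[OF Q(2)]
      by (subst Bochner_Integration.integral_add) auto
    moreover have "x * integral\<^sup>L Q\<^sub>0 X + (1 - x) * integral\<^sup>L Q\<^sub>1 X \<le> 0"
      using x Q0(5)[OF that] Q1(5)[OF that] by (intro add_nonpos_nonpos mult_nonneg_nonpos) auto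
    ultimately show ?thesis
      using integrable_real_density[of ?f P X] integral_real_density[of ?f P X] f
      unfolding mix_sep_measures_density[OF Q x] by simp
  qed
  ultimately show "?Q \<in> sep_measures P K"
    using Q0(2) by (simp add: sep_measures_def)
qed

lemma mix_mem_sep_measures:
  assumes "Q\<^sub>0 \<in> sep_measures P K" "Q\<^sub>1 \<in> sep_measures P K" "0 \<le> x" "x \<le> 1"
  shows "mix_measure x Q\<^sub>0 Q\<^sub>1 \<in> sep_measures P K"
  using convex_measures_sep_measures assms by (auto simp: convex_measures_def)

section \<open>Finite loss-entropy\<close>

context
  fixes \<Phi> :: "real \<Rightarrow> ereal"
  assumes entropy: "entropy_function \<Phi>"
begin

text \<open>The integrand of the loss-entropy as a function of the density's value, which turns the
  estimates below into inequalities between functions of real numbers.\<close>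

definition loss_entropy :: "real \<Rightarrow> ennreal" where
  "loss_entropy y = pos_entropy \<Phi> y * indicator {1..} y"

lemma finite_loss_entropy_measures_iff:
  "Q \<in> finite_loss_entropy_measures P K \<Phi> \<longleftrightarrow>
     Q \<in> sep_measures P K \<and> (\<integral>\<^sup>+ \<omega>. loss_entropy (dens P Q \<omega>) \<partial>P) < \<infinity>"
  by (simp add: finite_loss_entropy_measures_def loss_entropy_def pos_entropy_def indicator_def)

lemma measurable_pos_entropy_dens [measurable]:
  "(\<lambda>\<omega>. pos_entropy \<Phi> (dens P Q \<omega>)) \<in> borel_measurable P"
  using measurable_pos_entropy_comp[OF entropy borel_measurable_dens dens_nonneg] .

lemma measurable_loss_entropy_dens [measurable]:
  "(\<lambda>\<omega>. loss_entropy (dens P Q \<omega>)) \<in> borel_measurable P"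
  unfolding loss_entropy_def by measurable

text \<open>The two descriptions of finite entropy agree: the negative part of \<Phi> is always
  integrable along a density, being bounded by an affine function of it.\<close>

lemma ereal_integrable_entropy_iff:
  assumes "Q \<in> sep_measures P K"
  shows "ereal_integrable P (\<lambda>\<omega>. \<Phi> (dens P Q \<omega>)) \<longleftrightarrow>
    (\<integral>\<^sup>+ \<omega>. pos_entropy \<Phi> (dens P Q \<omega>) \<partial>P) < \<infinity>"
proof
  assume "ereal_integrable P (\<lambda>\<omega>. \<Phi> (dens P Q \<omega>))"
  then have fin: "(\<integral>\<^sup>+ \<omega>. e2ennreal \<bar>\<Phi> (dens P Q \<omega>)\<bar> \<partial>P) < \<infinity>"
    by (simp add: ereal_integrable_def)
  have "(\<integral>\<^sup>+ \<omega>. pos_entropy \<Phi> (dens P Q \<omega>) \<partial>P) \<le> (\<integral>\<^sup>+ \<omega>. e2ennreal \<bar>\<Phi> (dens P Q \<omega>)\<bar> \<partial>P)"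
  proof (intro nn_integral_mono)
    fix \<omega>
    have "max (\<Phi> (dens P Q \<omega>)) 0 \<le> \<bar>\<Phi> (dens P Q \<omega>)\<bar>"
      by (cases "\<Phi> (dens P Q \<omega>)") (auto simp: max_def)
    then show "pos_entropy \<Phi> (dens P Q \<omega>) \<le> e2ennreal \<bar>\<Phi> (dens P Q \<omega>)\<bar>"
      unfolding pos_entropy_def by (rule e2ennreal_mono)
  qed
  then show "(\<integral>\<^sup>+ \<omega>. pos_entropy \<Phi> (dens P Q \<omega>) \<partial>P) < \<infinity>"
    using fin by (rule le_less_trans)
next
  assume fin: "(\<integral>\<^sup>+ \<omega>. pos_entropy \<Phi> (dens P Q \<omega>) \<partial>P) < \<infinity>"
  obtain C where C: "C \<ge> 0"
    and bound: "\<And>y. y \<ge> 0 \<Longrightarrow> e2ennreal (- \<Phi> y) \<le> ennreal (C * (y + 1))"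
    using entropy_affine_lower_bound[OF entropy] by blast
  have "(\<integral>\<^sup>+ \<omega>. e2ennreal \<bar>\<Phi> (dens P Q \<omega>)\<bar> \<partial>P) \<le>
      (\<integral>\<^sup>+ \<omega>. pos_entropy \<Phi> (dens P Q \<omega>) + ennreal (C * (dens P Q \<omega> + 1)) \<partial>P)"
  proof (intro nn_integral_mono)
    fix \<omega>
    let ?y = "\<Phi> (dens P Q \<omega>)"
    have "e2ennreal \<bar>?y\<bar> \<le> e2ennreal (max ?y 0) + e2ennreal (- ?y)"
      by (cases ?y) (auto simp: max_def abs_if e2ennreal_neg)
    also have "\<dots> \<le> pos_entropy \<Phi> (dens P Q \<omega>) + ennreal (C * (dens P Q \<omega> + 1))"
      unfolding pos_entropy_def by (intro add_left_mono bound dens_nonneg)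
    finally show "e2ennreal \<bar>?y\<bar> \<le> \<dots>" .
  qed
  also have "\<dots> = (\<integral>\<^sup>+ \<omega>. pos_entropy \<Phi> (dens P Q \<omega>) \<partial>P) +
      (\<integral>\<^sup>+ \<omega>. ennreal (C * (dens P Q \<omega> + 1)) \<partial>P)"
    by (intro nn_integral_add) measurable
  also have "\<dots> < \<infinity>"
    using fin nn_integral_affine_dens_finite[OF prob sep_measuresD(1-3)[OF assms] C] by simp
  finally show "ereal_integrable P (\<lambda>\<omega>. \<Phi> (dens P Q \<omega>))"
    using measurable_entropy_comp[OF entropy borel_measurable_dens dens_nonneg]
    by (simp add: ereal_integrable_def)
qed

lemma finite_entropy_measures_iff:
  "Q \<in> finite_entropy_measures P K \<Phi> \<longleftrightarrow>
     Q \<in> sep_measures P K \<and> (\<integral>\<^sup>+ \<omega>. pos_entropy \<Phi> (dens P Q \<omega>) \<partial>P) < \<infinity>"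
  using ereal_integrable_entropy_iff by (auto simp: finite_entropy_measures_def)

lemma loss_entropy_convex_combination:
  assumes "u \<ge> 0" "v \<ge> 0" "0 \<le> x" "x \<le> 1"
  shows "loss_entropy (x * u + (1 - x) * v) \<le> pos_entropy \<Phi> 1 + (loss_entropy u + loss_entropy v)"
proof (cases "x * u + (1 - x) * v \<ge> 1")
  case True
  let ?y = "x * u + (1 - x) * v"
  have "?y \<le> max u v"
    using assms convex_bound_le[of u "max u v" v x "1 - x"] by simp
  then have "1 \<le> max u v" using True by simp
  have "pos_entropy \<Phi> ?y \<le> pos_entropy \<Phi> 1 + pos_entropy \<Phi> (max u v)"
    using True \<open>?y \<le> max u v\<close> by (intro pos_entropy_between[OF entropy]) auto
  \<comment> \<open>The larger of u and v is at least 1, so its own loss entropy is not cut off; the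
    other summand is nonnegative.\<close>
  also have "pos_entropy \<Phi> (max u v) \<le> loss_entropy u + loss_entropy v"
    using \<open>1 \<le> max u v\<close> by (auto simp: loss_entropy_def max_def)
  finally show ?thesis using True by (simp add: loss_entropy_def add_left_mono)
qed (simp add: loss_entropy_def)

lemma convex_measures_finite_loss_entropy:
  "convex_measures (finite_loss_entropy_measures P K \<Phi>)"
  unfolding convex_measures_def
proof (intro ballI allI impI)
  fix Q\<^sub>0 Q\<^sub>1 and x :: real
  assume "Q\<^sub>0 \<in> finite_loss_entropy_measures P K \<Phi>" "Q\<^sub>1 \<in> finite_loss_entropy_measures P K \<Phi>"
    and "0 \<le> x \<and> x \<le> 1"
  then have Q: "Q\<^sub>0 \<in> sep_measures P K" "Q\<^sub>1 \<in> sep_measures P K"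
    and fin: "(\<integral>\<^sup>+ \<omega>. loss_entropy (dens P Q\<^sub>0 \<omega>) \<partial>P) < \<infinity>"
      "(\<integral>\<^sup>+ \<omega>. loss_entropy (dens P Q\<^sub>1 \<omega>) \<partial>P) < \<infinity>"
    and x: "0 \<le> x" "x \<le> 1"
    by (auto simp: finite_loss_entropy_measures_iff)
  have "(\<integral>\<^sup>+ \<omega>. loss_entropy (dens P (mix_measure x Q\<^sub>0 Q\<^sub>1) \<omega>) \<partial>P) \<le>
    (\<integral>\<^sup>+ \<omega>. pos_entropy \<Phi> 1 + (loss_entropy (dens P Q\<^sub>0 \<omega>) + loss_entropy (dens P Q\<^sub>1 \<omega>)) \<partial>P)"
    using AE_dens_mix[OF Q x]
    by (intro nn_integral_mono_AE, eventually_elim)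
      (simp add: loss_entropy_convex_combination dens_nonneg x)
  also have "\<dots> = pos_entropy \<Phi> 1 +
      ((\<integral>\<^sup>+ \<omega>. loss_entropy (dens P Q\<^sub>0 \<omega>) \<partial>P) + (\<integral>\<^sup>+ \<omega>. loss_entropy (dens P Q\<^sub>1 \<omega>) \<partial>P))"
    by (simp add: nn_integral_add P.emeasure_space_1)
  also have "\<dots> < \<infinity>"
    using fin pos_entropy_finite[OF entropy, of 1] by simp
  finally show "mix_measure x Q\<^sub>0 Q\<^sub>1 \<in> finite_loss_entropy_measures P K \<Phi>"
    using mix_mem_sep_measures[OF Q x] by (simp add: finite_loss_entropy_measures_iff)
qed

section \<open>Face property and finite entropy of mixtures under the growth condition\<close>

context
  assumes growth: "growth_condition \<Phi>"
begin

text \<open>Growth with factor 1 / x compares \<open>\<Phi>\<^sup>+\<close> at the component's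
  density u with \<open>\<Phi>\<^sup>+\<close> at the mixed density y. The loss entropy of the
  mixture does not see y < 1, but y stays above x > 0 where u \<ge> 1, and
  \<open>\<Phi>\<^sup>+\<close> is bounded on [x, 1].\<close>

lemma finite_loss_entropy_mixD:
  assumes Q: "Q\<^sub>0 \<in> sep_measures P K" "Q\<^sub>1 \<in> sep_measures P K" and x: "0 < x" "x < 1"
    and mix: "mix_measure x Q\<^sub>0 Q\<^sub>1 \<in> finite_loss_entropy_measures P K \<Phi>"
  shows "Q\<^sub>0 \<in> finite_loss_entropy_measures P K \<Phi>"
proof -
  let ?Q = "mix_measure x Q\<^sub>0 Q\<^sub>1"
  obtain \<alpha> \<beta> where ab: "\<alpha> \<ge> 0" "\<beta> \<ge> 0" and scale: "\<And>y. y > 0 \<Longrightarrow>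
      pos_entropy \<Phi> (1 / x * y) \<le> ennreal \<alpha> * pos_entropy \<Phi> y + ennreal (\<beta> * (y + 1))"
    using pos_entropy_scale[OF entropy growth, of "1 / x"] x by auto
  \<comment> \<open>Collects the contributions of the endpoints x and 1; both are positive, so c is
    finite even if \<Phi> 0 = \<infinity>.\<close>
  define c where "c = pos_entropy \<Phi> 1 + ennreal \<alpha> * (pos_entropy \<Phi> x + pos_entropy \<Phi> 1)"
  have c: "c < \<infinity>"
    using pos_entropy_finite[OF entropy] x by (auto simp: c_def ennreal_mult_less_top)
  \<comment> \<open>Where \<open>u \<ge> 1\<close>, the mixed density \<open>y\<close> satisfies \<open>x \<le> y\<close> and \<open>1 \<le> u \<le> y / x\<close>.\<close>
  have bound: "loss_entropy u \<le> c + (ennreal \<alpha> * loss_entropy y + ennreal (\<beta> * (y + 1)))"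
    if "v \<ge> 0" and y: "y = x * u + (1 - x) * v" for u v y
  proof (cases "u \<ge> 1")
    case True
    have xu: "x * u \<le> y" using that x by simp
    have "x * 1 \<le> x * u" using True x by (intro mult_left_mono) auto
    then have xy: "x \<le> y" using xu by simp
    have "u \<le> 1 / x * y" using xu x by (simp add: field_simps)
    have small: "pos_entropy \<Phi> y \<le> (pos_entropy \<Phi> x + pos_entropy \<Phi> 1) + loss_entropy y"
    proof (cases "y \<ge> 1")
      case False
      then show ?thesis
        using pos_entropy_between[OF entropy, of x y 1] x xy by (simp add: loss_entropy_def)
    qed (simp add: loss_entropy_def)
    have "pos_entropy \<Phi> u \<le> pos_entropy \<Phi> 1 + pos_entropy \<Phi> (1 / x * y)"
      using True \<open>u \<le> 1 / x * y\<close> by (intro pos_entropy_between[OF entropy]) auto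
    also have "\<dots> \<le> pos_entropy \<Phi> 1 + (ennreal \<alpha> * pos_entropy \<Phi> y + ennreal (\<beta> * (y + 1)))"
      using x xy by (intro add_left_mono scale) auto
    also have "\<dots> \<le> pos_entropy \<Phi> 1 + (ennreal \<alpha> *
        ((pos_entropy \<Phi> x + pos_entropy \<Phi> 1) + loss_entropy y) + ennreal (\<beta> * (y + 1)))"
      by (intro add_left_mono add_right_mono mult_left_mono small) simp
    also have "\<dots> = c + (ennreal \<alpha> * loss_entropy y + ennreal (\<beta> * (y + 1)))"
      by (simp add: c_def distrib_left add_ac)
    finally show ?thesis using True by (simp add: loss_entropy_def)
  qed (simp add: loss_entropy_def)
  have Qsep: "?Q \<in> sep_measures P K" and fin: "(\<integral>\<^sup>+ \<omega>. loss_entropy (dens P ?Q \<omega>) \<partial>P) < \<infinity>"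
    using mix by (auto simp: finite_loss_entropy_measures_iff)
  have "(\<integral>\<^sup>+ \<omega>. loss_entropy (dens P Q\<^sub>0 \<omega>) \<partial>P) \<le> (\<integral>\<^sup>+ \<omega>. c +
      (ennreal \<alpha> * loss_entropy (dens P ?Q \<omega>) + ennreal (\<beta> * (dens P ?Q \<omega> + 1))) \<partial>P)"
    using AE_dens_mix[OF Q, of x] x
    by (intro nn_integral_mono_AE) (auto elim!: eventually_mono intro: bound[OF dens_nonneg])
  also have "\<dots> = c + (ennreal \<alpha> * (\<integral>\<^sup>+ \<omega>. loss_entropy (dens P ?Q \<omega>) \<partial>P) +
      (\<integral>\<^sup>+ \<omega>. ennreal (\<beta> * (dens P ?Q \<omega> + 1)) \<partial>P))"
    by (simp add: nn_integral_add nn_integral_cmult P.emeasure_space_1)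
  also have "\<dots> < \<infinity>"
    using fin c nn_integral_affine_dens_finite[OF prob sep_measuresD(1-3)[OF Qsep] ab(2)]
    by (simp add: ennreal_mult_less_top)
  finally show ?thesis using Q by (simp add: finite_loss_entropy_measures_iff)
qed

text \<open>Where the mixed density y is at least 1, its loss entropy gives the bound. Elsewhere y
  lies between x u and 1, with u the density of the component of finite entropy, and growth with
  factor x controls \<open>\<Phi>\<^sup>+\<close> at x u.\<close>

lemma finite_entropy_mixI:
  assumes Q: "Q\<^sub>0 \<in> sep_measures P K" "Q\<^sub>1 \<in> sep_measures P K" and x: "0 < x" "x < 1"
    and mix: "mix_measure x Q\<^sub>0 Q\<^sub>1 \<in> finite_loss_entropy_measures P K \<Phi>"
    and Q0: "Q\<^sub>0 \<in> finite_entropy_measures P K \<Phi>"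
  shows "mix_measure x Q\<^sub>0 Q\<^sub>1 \<in> finite_entropy_measures P K \<Phi>"
proof -
  let ?Q = "mix_measure x Q\<^sub>0 Q\<^sub>1"
  obtain \<alpha> \<beta> where ab: "\<alpha> \<ge> 0" "\<beta> \<ge> 0" and scale: "\<And>y. y > 0 \<Longrightarrow>
      pos_entropy \<Phi> (x * y) \<le> ennreal \<alpha> * pos_entropy \<Phi> y + ennreal (\<beta> * (y + 1))"
    using pos_entropy_scale[OF entropy growth, of x] x by auto
  \<comment> \<open>The summand \<open>1\<close> in \<open>\<alpha> + 1\<close> covers \<open>u = 0\<close>, where the growth condition says nothing.\<close>
  have scale0: "pos_entropy \<Phi> (x * u) \<le> ennreal (\<alpha> + 1) * pos_entropy \<Phi> u + ennreal (\<beta> * (u + 1))"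
    if "u \<ge> 0" for u
  proof (cases "u = 0")
    case True
    have "pos_entropy \<Phi> 0 \<le> ennreal (\<alpha> + 1) * pos_entropy \<Phi> 0 + ennreal \<beta>"
      using ab by (simp add: ennreal_plus distrib_right add_increasing add_increasing2)
    then show ?thesis using True by simp
  next
    case False
    then have "pos_entropy \<Phi> (x * u) \<le> ennreal \<alpha> * pos_entropy \<Phi> u + ennreal (\<beta> * (u + 1))"
      using that by (intro scale) auto
    also have "\<dots> \<le> ennreal (\<alpha> + 1) * pos_entropy \<Phi> u + ennreal (\<beta> * (u + 1))"
      using ab by (intro add_right_mono mult_right_mono ennreal_leI) auto
    finally show ?thesis .
  qed
  have bound: "pos_entropy \<Phi> y \<le> pos_entropy \<Phi> 1 + (loss_entropy y +
      (ennreal (\<alpha> + 1) * pos_entropy \<Phi> u + ennreal (\<beta> * (u + 1))))"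
    if "u \<ge> 0" "v \<ge> 0" and y: "y = x * u + (1 - x) * v" for u v y
  proof (cases "y \<ge> 1")
    case True
    then show ?thesis by (simp add: loss_entropy_def add_increasing add_increasing2)
  next
    case False
    \<comment> \<open>The left endpoint x u may be 0 with \<Phi> 0 = \<infinity>; then u = 0 too,
      and the final bound is infinite as well.\<close>
    have "pos_entropy \<Phi> y \<le> pos_entropy \<Phi> (x * u) + pos_entropy \<Phi> 1"
      using False that x by (intro pos_entropy_between[OF entropy]) auto
    also have "\<dots> \<le> (ennreal (\<alpha> + 1) * pos_entropy \<Phi> u + ennreal (\<beta> * (u + 1))) + pos_entropy \<Phi> 1"
      by (intro add_right_mono scale0 that)
    finally show ?thesis using False by (simp add: loss_entropy_def add_ac)
  qed
  have Qsep: "?Q \<in> sep_measures P K" and fin: "(\<integral>\<^sup>+ \<omega>. loss_entropy (dens P ?Q \<omega>) \<partial>P) < \<infinity>"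
    and fin0: "(\<integral>\<^sup>+ \<omega>. pos_entropy \<Phi> (dens P Q\<^sub>0 \<omega>) \<partial>P) < \<infinity>"
    using mix Q0 by (auto simp: finite_loss_entropy_measures_iff finite_entropy_measures_iff)
  have "(\<integral>\<^sup>+ \<omega>. pos_entropy \<Phi> (dens P ?Q \<omega>) \<partial>P) \<le> (\<integral>\<^sup>+ \<omega>. pos_entropy \<Phi> 1 +
      (loss_entropy (dens P ?Q \<omega>) + (ennreal (\<alpha> + 1) * pos_entropy \<Phi> (dens P Q\<^sub>0 \<omega>) +
        ennreal (\<beta> * (dens P Q\<^sub>0 \<omega> + 1)))) \<partial>P)"
    using AE_dens_mix[OF Q, of x] x
    by (intro nn_integral_mono_AE) (auto elim!: eventually_mono intro: bound[OF dens_nonneg dens_nonneg])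
  also have "\<dots> = pos_entropy \<Phi> 1 + ((\<integral>\<^sup>+ \<omega>. loss_entropy (dens P ?Q \<omega>) \<partial>P) +
      (ennreal (\<alpha> + 1) * (\<integral>\<^sup>+ \<omega>. pos_entropy \<Phi> (dens P Q\<^sub>0 \<omega>) \<partial>P) +
        (\<integral>\<^sup>+ \<omega>. ennreal (\<beta> * (dens P Q\<^sub>0 \<omega> + 1)) \<partial>P)))"
    by (simp add: nn_integral_add nn_integral_cmult P.emeasure_space_1)
  also have "\<dots> < \<infinity>"
    using fin fin0 pos_entropy_finite[OF entropy, of 1]
      nn_integral_affine_dens_finite[OF prob sep_measuresD(1-3)[OF Q(1)] ab(2)]
    by (simp add: ennreal_mult_less_top)
  finally show ?thesis using Qsep by (simp add: finite_entropy_measures_iff)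
qed

lemma face_measures_finite_loss_entropy:
  "face_measures (finite_loss_entropy_measures P K \<Phi>) (sep_measures P K)"
  unfolding face_measures_def
proof (intro conjI ballI allI impI)
  fix Q\<^sub>0 Q\<^sub>1 and a :: real
  assume Q: "Q\<^sub>0 \<in> sep_measures P K" "Q\<^sub>1 \<in> sep_measures P K"
    and a: "0 < a \<and> a < 1 \<and> mix_measure a Q\<^sub>0 Q\<^sub>1 \<in> finite_loss_entropy_measures P K \<Phi>"
  then show "Q\<^sub>0 \<in> finite_loss_entropy_measures P K \<Phi>"
    using finite_loss_entropy_mixD by blast
  \<comment> \<open>Exchanging the components, with weight 1 - a, reduces the second one to the case
    already treated.\<close>
  have "mix_measure a Q\<^sub>0 Q\<^sub>1 = mix_measure (1 - a) Q\<^sub>1 Q\<^sub>0"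
    using sep_measuresD(2)[OF Q(1)] sep_measuresD(2)[OF Q(2)] by (intro mix_measure_commute) simp
  then show "Q\<^sub>1 \<in> finite_loss_entropy_measures P K \<Phi>"
    using a finite_loss_entropy_mixD[OF Q(2,1), of "1 - a"] by simp
qed (auto simp: convex_measures_sep_measures convex_measures_finite_loss_entropy
    finite_loss_entropy_measures_iff)

end

end

end

theorem lemma4p5:
  fixes P :: "'a measure" and K :: "('a \<Rightarrow> real) set" and \<Phi> :: "real \<Rightarrow> ereal"
  assumes "prob_space P"
    and "L0_wedge P K"
    and "entropy_function \<Phi>"
    and "growth_condition \<Phi>"
  shows "face_measures (finite_loss_entropy_measures P K \<Phi>) (sep_measures P K) \<and>
    (\<forall>Q\<^sub>0\<in>sep_measures P K. \<forall>Q\<^sub>1\<in>sep_measures P K. \<forall>x::real. 0 < x \<and> x < 1 \<longrightarrow>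
       mix_measure x Q\<^sub>0 Q\<^sub>1 \<in> finite_loss_entropy_measures P K \<Phi> \<longrightarrow>
       Q\<^sub>0 \<in> finite_entropy_measures P K \<Phi> \<or> Q\<^sub>1 \<in> finite_entropy_measures P K \<Phi> \<longrightarrow>
       mix_measure x Q\<^sub>0 Q\<^sub>1 \<in> finite_entropy_measures P K \<Phi>)"
proof (intro conjI ballI allI impI)
  show "face_measures (finite_loss_entropy_measures P K \<Phi>) (sep_measures P K)"
    using assms(1,3,4) by (rule face_measures_finite_loss_entropy)
next
  fix Q\<^sub>0 Q\<^sub>1 and x :: real
  assume Q: "Q\<^sub>0 \<in> sep_measures P K" "Q\<^sub>1 \<in> sep_measures P K" and x: "0 < x \<and> x < 1"
    and mix: "mix_measure x Q\<^sub>0 Q\<^sub>1 \<in> finite_loss_entropy_measures P K \<Phi>"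
    and "Q\<^sub>0 \<in> finite_entropy_measures P K \<Phi> \<or> Q\<^sub>1 \<in> finite_entropy_measures P K \<Phi>"
  then consider "Q\<^sub>0 \<in> finite_entropy_measures P K \<Phi>" | "Q\<^sub>1 \<in> finite_entropy_measures P K \<Phi>"
    by blast
  then show "mix_measure x Q\<^sub>0 Q\<^sub>1 \<in> finite_entropy_measures P K \<Phi>"
  proof cases
    case 1
    then show ?thesis
      using finite_entropy_mixI[OF assms(1,3,4) Q] x mix by blast
  next
    case 2
    \<comment> \<open>By symmetry the component of finite entropy may be put first, with weight 1 -
      x.\<close>
    have "mix_measure x Q\<^sub>0 Q\<^sub>1 = mix_measure (1 - x) Q\<^sub>1 Q\<^sub>0"
      using sep_measuresD(2)[OF assms(1) Q(1)] sep_measuresD(2)[OF assms(1) Q(2)]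
      by (intro mix_measure_commute) simp
    then show ?thesis
      using finite_entropy_mixI[OF assms(1,3,4) Q(2,1), of "1 - x"] x mix 2 by simp
  qed
qed

end
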